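(* Let $(X,\mathcal P(A),C+\rho\Omega,P)$ be a regularized model with discount factor $\beta\in(0,1)$ (as described in the context), and suppose that the Lipschitz assumption on $(c,p)$ holds with constants $L_1,K_1$. Let $\bar L=\frac{L_1}{1-\beta K_1/2}$ and $K_{\mathrm D}=K_1+\min\{1,\frac32K_1\}$. If $$K_{\mathrm D}<1,\qquad \frac{\bar LK_1}{\rho}<\beta(1-K_{\mathrm D})^2,\qquad \sqrt\beta\left(\sqrt{K_{\mathrm D}+\frac{\bar LK_1}{\rho}}+\sqrt{\frac{\bar LK_1}{\rho}}\right)<1,$$ then for every $Q_{\mathrm{terminal}}\in\mathcal C_\beta$ the time-reversed mean-field equilibrium with terminal Q-function $Q_{\mathrm{terminal}}$ is unique, i.e. $\mathrm{TRMFE}_{Q_{\mathrm{terminal}}}$ has exactly one element.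
   Context: Setting. $X$ and $A$ are finite nonempty sets with the discrete metric; $\mathcal P(E)$ is the set of probability measures on $E$; $\mathcal P(X)$, $\mathcal P(A)$ carry the norm $\|\cdot\|_1$. $c:X\times A\times\mathcal P(X)\to[0,\infty)$ is a cost function and $p:X\times A\times\mathcal P(X)\to\mathcal P(X)$ a transition kernel. For $u\in\mathcal P(A)$ put $C(x,u,\mu)=\sum_{a}c(x,a,\mu)u(a)$ and $P(\cdot\mid x,u,\mu)=\sum_a p(\cdot\mid x,a,\mu)u(a)$. $\rho>0$ and $\Omega:\mathcal P(A)\to\mathbb R$ is 1-strongly convex for $\|\cdot\|_1$: $\Omega(\theta u+(1-\theta)v)\le\theta\Omega(u)+(1-\theta)\Omega(v)-\frac12\theta(1-\theta)\|u-v\|_1^2$ for $u,v\in\mathcal P(A)$, $\theta\in[0,1]$. Q-functions are functions $Q:X\times\mathcal P(A)\to\mathbb R$. For $Q$ of the form (affine in $u$) $+\rho\Omega(u)$, $Q(x,\cdot)$ is taken to have a unique minimizer $u_Q(x)\in\mathcal P(A)$, and $\pi_Q(\cdot\mid x)=\delta_{u_Q(x)}$. A policy is a kernel $\pi:X\to\mathcal P(\mathcal P(A))$. Operators: $$H_1(Q,\mu)(x,u)=C(x,u,\mu)+\rho\Omega(u)+\beta\sum_{y\in X}\min_{v\in\mathcal P(A)}Q(y,v)\,P(y\mid x,u,\mu),$$ $$H_2(\pi,\mu)(\cdot)=\sum_{x\in X}\int_{\mathcal P(A)}P(\cdot\mid x,u,\mu)\,\pi(du\mid x)\,\mu(x).$$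 Lipschitz assumption. For all $x,\hat x,a,\hat a,\mu,\hat\mu$: $|c(x,a,\mu)-c(\hat x,\hat a,\hat\mu)|\le L_1(1_{\{x\ne\hat x\}}+2\cdot 1_{\{a\ne\hat a\}}+\|\mu-\hat\mu\|_1)$ and $\|p(\cdot|x,a,\mu)-p(\cdot|\hat x,\hat a,\hat\mu)\|_1\le K_1(1_{\{x\ne\hat x\}}+2\cdot1_{\{a\ne\hat a\}}+\|\mu-\hat\mu\|_1)$. Domain. $M:=\sup C$. $\tilde{\mathcal C}_\beta$ is the set of $q:X\times A\to\mathbb R_+$ with $\|q\|_\infty\le\frac{M}{1-\beta}$ and $|q(x,a)-q(\tilde x,\tilde a)|\le\frac{L_1}{1-\beta K_1/2}(1_{\{x\ne\tilde x\}}+2\cdot1_{\{a\ne\tilde a\}})$. $\mathcal C_\beta$ is the set of $Q(x,u)=\sum_a q(x,a)u(a)+\rho\Omega(u)$ with $q\in\tilde{\mathcal C}_\beta$. $\mathrm{TRMFE}_{Q_{\mathrm{terminal}}}$ (time-reversed mean-field equilibria): all families $(\pi_{-t},\mu_{-t})_{t=0}^\infty$ of policies and state measures for which there are Q-functions $(Q_{-t})_{t\ge0}$ with $Q_0=Q_{\mathrm{terminal}}$, $Q_{-t-1}=H_1(Q_{-t},\mu_{-t-1})$, $\mu_{-t}=H_2(\pi_{-t-1},\mu_{-t-1})$ for all $t\ge0$, and, for all $t\ge0$ and $x\in X$, $\pi_{-t}(\cdot\mid x)$ supported on the minimizers of $Q_{-t}(x,\cdot)$. *)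

theory Defs
  imports "HOL-Probability.Probability"
begin

text \<open>The finite sets \<open>X\<close> and \<open>A\<close> are finite types \<open>'x\<close> and \<open>'a\<close>. A probability measure on such a
  type is its weight vector, an element of \<open>prob_simplex\<close>; functions of probability measures are
  total functions on vectors whose values off the simplex are never used.\<close>

definition prob_simplex :: "(real ^ 'e::finite) set" where
  "prob_simplex = {m. (\<forall>i. 0 \<le> m $ i) \<and> (\<Sum>i\<in>UNIV. m $ i) = 1}"

definition norm1 :: "real ^ 'e::finite \<Rightarrow> real" where
  "norm1 m = (\<Sum>i\<in>UNIV. \<bar>m $ i\<bar>)"

definition simplex_borel :: "(real ^ 'e::finite) measure" where
  "simplex_borel = restrict_space borel prob_simplex"

definition transition_kernel ::
  "('x::finite \<Rightarrow> 'a::finite \<Rightarrow> real ^ 'x \<Rightarrow> real ^ 'x) \<Rightarrow> bool" where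
  "transition_kernel p \<longleftrightarrow> (\<forall>x a. \<forall>\<mu>\<in>prob_simplex. p x a \<mu> \<in> prob_simplex)"

definition mean_cost ::
  "('x::finite \<Rightarrow> 'a::finite \<Rightarrow> real ^ 'x \<Rightarrow> real) \<Rightarrow> 'x \<Rightarrow> real ^ 'a \<Rightarrow> real ^ 'x \<Rightarrow> real" where
  "mean_cost c x u \<mu> = (\<Sum>a\<in>UNIV. c x a \<mu> * u $ a)"

definition mean_kernel ::
  "('x::finite \<Rightarrow> 'a::finite \<Rightarrow> real ^ 'x \<Rightarrow> real ^ 'x) \<Rightarrow> 'x \<Rightarrow> real ^ 'a \<Rightarrow> real ^ 'x \<Rightarrow> real ^ 'x" where
  "mean_kernel p x u \<mu> = (\<chi> y. \<Sum>a\<in>UNIV. p x a \<mu> $ y * u $ a)"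

definition strongly_convex1 :: "(real ^ 'a::finite \<Rightarrow> real) \<Rightarrow> bool" where
  "strongly_convex1 \<Omega> \<longleftrightarrow>
     (\<forall>u\<in>prob_simplex. \<forall>v\<in>prob_simplex. \<forall>\<theta>\<in>{0..1}.
        \<Omega> (\<theta> *\<^sub>R u + (1 - \<theta>) *\<^sub>R v)
          \<le> \<theta> * \<Omega> u + (1 - \<theta>) * \<Omega> v - 1 / 2 * \<theta> * (1 - \<theta>) * (norm1 (u - v))\<^sup>2)"

abbreviation minimizer :: "(real ^ 'a::finite \<Rightarrow> real) \<Rightarrow> real ^ 'a \<Rightarrow> bool" where
  "minimizer f \<equiv> is_arg_min f (\<lambda>u. u \<in> prob_simplex)"

text \<open>The weights of \<open>u\<close> sum to 1, so on the simplex every affine function is of the form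
  \<open>u \<mapsto> \<Sum>a. q a * u $ a\<close>. Strong convexity alone does not give existence of a minimizer, as \<open>\<Omega>\<close> may
  fail to be lower semicontinuous at the boundary.\<close>

definition unique_minimizers :: "real \<Rightarrow> (real ^ 'a::finite \<Rightarrow> real) \<Rightarrow> bool" where
  "unique_minimizers \<rho> \<Omega> \<longleftrightarrow>
     (\<forall>q :: 'a \<Rightarrow> real. \<exists>!u. minimizer (\<lambda>u. (\<Sum>a\<in>UNIV. q a * u $ a) + \<rho> * \<Omega> u) u)"

definition lipschitz_model ::
  "('x::finite \<Rightarrow> 'a::finite \<Rightarrow> real ^ 'x \<Rightarrow> real) \<Rightarrow> ('x \<Rightarrow> 'a \<Rightarrow> real ^ 'x \<Rightarrow> real ^ 'x)
     \<Rightarrow> real \<Rightarrow> real \<Rightarrow> bool" where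
  "lipschitz_model c p L1 K1 \<longleftrightarrow>
     (\<forall>x x' a a'. \<forall>\<mu>\<in>prob_simplex. \<forall>\<mu>'\<in>prob_simplex.
        \<bar>c x a \<mu> - c x' a' \<mu>'\<bar>
          \<le> L1 * (of_bool (x \<noteq> x') + 2 * of_bool (a \<noteq> a') + norm1 (\<mu> - \<mu>')) \<and>
        norm1 (p x a \<mu> - p x' a' \<mu>')
          \<le> K1 * (of_bool (x \<noteq> x') + 2 * of_bool (a \<noteq> a') + norm1 (\<mu> - \<mu>')))"

text \<open>The infimum over \<open>v\<close> is attained for all Q-functions of the form affine plus \<open>\<rho> * \<Omega>\<close> whenever
  \<open>unique_minimizers \<rho> \<Omega>\<close> holds.\<close>

definition H1 ::
  "('x::finite \<Rightarrow> 'a::finite \<Rightarrow> real ^ 'x \<Rightarrow> real) \<Rightarrow> ('x \<Rightarrow> 'a \<Rightarrow> real ^ 'x \<Rightarrow> real ^ 'x)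
     \<Rightarrow> real \<Rightarrow> real \<Rightarrow> (real ^ 'a \<Rightarrow> real)
     \<Rightarrow> ('x \<Rightarrow> real ^ 'a \<Rightarrow> real) \<Rightarrow> real ^ 'x \<Rightarrow> 'x \<Rightarrow> real ^ 'a \<Rightarrow> real" where
  "H1 c p \<beta> \<rho> \<Omega> Q \<mu> x u =
     mean_cost c x u \<mu> + \<rho> * \<Omega> u
       + \<beta> * (\<Sum>y\<in>UNIV. (INF v\<in>prob_simplex. Q y v) * mean_kernel p x u \<mu> $ y)"

definition H2 ::
  "('x::finite \<Rightarrow> 'a::finite \<Rightarrow> real ^ 'x \<Rightarrow> real ^ 'x)
     \<Rightarrow> ('x \<Rightarrow> (real ^ 'a) measure) \<Rightarrow> real ^ 'x \<Rightarrow> real ^ 'x" where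
  "H2 p \<pi> \<mu> = (\<chi> y. \<Sum>x\<in>UNIV. (\<integral>u. mean_kernel p x u \<mu> $ y \<partial>\<pi> x) * \<mu> $ x)"

definition policies :: "('x::finite \<Rightarrow> (real ^ 'a::finite) measure) set" where
  "policies = {\<pi>. \<forall>x. \<pi> x \<in> space (prob_algebra simplex_borel)}"

definition max_cost :: "('x::finite \<Rightarrow> 'a::finite \<Rightarrow> real ^ 'x \<Rightarrow> real) \<Rightarrow> real" where
  "max_cost c = (SUP (x, u, \<mu>)\<in>UNIV \<times> prob_simplex \<times> prob_simplex. mean_cost c x u \<mu>)"

definition C_tilde ::
  "('x::finite \<Rightarrow> 'a::finite \<Rightarrow> real ^ 'x \<Rightarrow> real) \<Rightarrow> real \<Rightarrow> real \<Rightarrow> real \<Rightarrow> ('x \<Rightarrow> 'a \<Rightarrow> real) set" where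
  "C_tilde c L1 K1 \<beta> =
     {q. (\<forall>x a. 0 \<le> q x a \<and> q x a \<le> max_cost c / (1 - \<beta>)) \<and>
         (\<forall>x x' a a'. \<bar>q x a - q x' a'\<bar>
            \<le> L1 / (1 - \<beta> * K1 / 2) * (of_bool (x \<noteq> x') + 2 * of_bool (a \<noteq> a')))}"

definition C_reg ::
  "('x::finite \<Rightarrow> 'a::finite \<Rightarrow> real ^ 'x \<Rightarrow> real) \<Rightarrow> real \<Rightarrow> real \<Rightarrow> real \<Rightarrow> real
     \<Rightarrow> (real ^ 'a \<Rightarrow> real) \<Rightarrow> ('x \<Rightarrow> real ^ 'a \<Rightarrow> real) set" where
  "C_reg c L1 K1 \<beta> \<rho> \<Omega> =
     {Q. \<exists>q\<in>C_tilde c L1 K1 \<beta>. \<forall>x. \<forall>u\<in>prob_simplex.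
           Q x u = (\<Sum>a\<in>UNIV. q x a * u $ a) + \<rho> * \<Omega> u}"

text \<open>Time is reversed: \<open>\<pi> t\<close>, \<open>\<mu> t\<close>, \<open>Q t\<close> are the objects at time \<open>-t\<close>, so that \<open>t = 0\<close> is terminal and
  \<open>Suc t\<close> precedes \<open>t\<close>. Q-functions are compared on the simplex only.\<close>

definition TRMFE ::
  "('x::finite \<Rightarrow> 'a::finite \<Rightarrow> real ^ 'x \<Rightarrow> real) \<Rightarrow> ('x \<Rightarrow> 'a \<Rightarrow> real ^ 'x \<Rightarrow> real ^ 'x)
     \<Rightarrow> real \<Rightarrow> real \<Rightarrow> (real ^ 'a \<Rightarrow> real) \<Rightarrow> ('x \<Rightarrow> real ^ 'a \<Rightarrow> real)
     \<Rightarrow> ((nat \<Rightarrow> 'x \<Rightarrow> (real ^ 'a) measure) \<times> (nat \<Rightarrow> real ^ 'x)) set" where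
  "TRMFE c p \<beta> \<rho> \<Omega> Q_terminal =
     {(\<pi>, \<mu>).
        (\<forall>t. \<pi> t \<in> policies \<and> \<mu> t \<in> prob_simplex) \<and>
        (\<exists>Q :: nat \<Rightarrow> 'x \<Rightarrow> real ^ 'a \<Rightarrow> real.
           (\<forall>x. \<forall>u\<in>prob_simplex. Q 0 x u = Q_terminal x u) \<and>
           (\<forall>t x. \<forall>u\<in>prob_simplex. Q (Suc t) x u = H1 c p \<beta> \<rho> \<Omega> (Q t) (\<mu> (Suc t)) x u) \<and>
           (\<forall>t. \<mu> t = H2 p (\<pi> (Suc t)) (\<mu> (Suc t))) \<and>
           (\<forall>t x. AE u in \<pi> t x. minimizer (Q t x) u))}"

end

theory Submission
  imports Defs
begin

text \<open>Minimizers being unique, an equilibrium is determined by its state measures \<open>\<mu>\<close>, which are the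
  fixed points of the map sending a sequence \<open>\<mu>\<close> to the flow generated by the greedy policies of
  the Q-functions computed from \<open>\<mu>\<close>. If \<open>d t\<close> is the \<open>norm1\<close>-distance of two input sequences at time
  \<open>-t\<close>, the Q-functions at time \<open>-t\<close> differ by at most \<open>\<Sum>s=1..t. \<beta> ^ (t - s) * Lbar * d s\<close>, the greedy actions
  by \<open>1 / \<rho>\<close> times as much (strong convexity), and the outputs at time \<open>-t\<close> by at most
  \<open>KD * d (t + 1) + \<kappa> * (\<Sum>s=1..t+1. \<beta> ^ (t + 1 - s) * d s)\<close> with \<open>\<kappa> = Lbar * K1 / \<rho>\<close>. In the weighted
  metric \<open>SUP t. r ^ t * d t\<close> with \<open>0 < r \<le> 1\<close> this is a contraction as soon as
  \<open>\<kappa> < (r - KD) * (1 - \<beta> * r)\<close>, and the hypotheses on the constants provide such an \<open>r\<close>.\<close>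

section \<open>The simplex and the 1-norm\<close>

lemma prob_simplex_nonneg: "m \<in> prob_simplex \<Longrightarrow> 0 \<le> m $ i"
  by (simp add: prob_simplex_def)

lemma prob_simplex_sum: "m \<in> prob_simplex \<Longrightarrow> (\<Sum>i\<in>UNIV. m $ i) = 1"
  by (simp add: prob_simplex_def)

lemma prob_simplex_nonempty: "prob_simplex \<noteq> ({} :: (real ^ 'e::finite) set)"
proof -
  have "axis i 1 \<in> (prob_simplex :: (real ^ 'e) set)" for i
    by (auto simp: prob_simplex_def axis_def sum.delta)
  then show ?thesis
    by blast
qed

lemma closed_prob_simplex: "closed (prob_simplex :: (real ^ 'e::finite) set)"
  unfolding prob_simplex_def
  by (intro closed_Collect_conj closed_Collect_all closed_Collect_le closed_Collect_eq continuous_intros)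

lemma norm1_nonneg: "0 \<le> norm1 m"
  by (simp add: norm1_def sum_nonneg)

lemma norm1_zero [simp]: "norm1 0 = 0"
  by (simp add: norm1_def)

lemma norm1_minus_commute: "norm1 (m - m') = norm1 (m' - m)"
  by (simp add: norm1_def abs_minus_commute)

lemma norm1_triangle: "norm1 (m + m') \<le> norm1 m + norm1 m'"
  by (auto simp: norm1_def simp flip: sum.distrib intro!: sum_mono)

lemma norm_le_norm1: "norm m \<le> norm1 m"
  unfolding norm1_def by (rule norm_le_l1_cart)

lemma norm1_prob_simplex: "m \<in> prob_simplex \<Longrightarrow> norm1 m = 1"
  by (simp add: norm1_def prob_simplex_def)

lemma norm1_diff_le_2:
  assumes "m \<in> prob_simplex" "m' \<in> prob_simplex"
  shows "norm1 (m - m') \<le> 2"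
proof -
  have "norm1 (m - m') \<le> norm1 m + norm1 m'"
    by (auto simp: norm1_def simp flip: sum.distrib intro!: sum_mono)
  then show ?thesis
    using assms by (simp add: norm1_prob_simplex)
qed

lemma tendsto_norm1: "(f \<longlongrightarrow> l) F \<Longrightarrow> ((\<lambda>n. norm1 (f n)) \<longlongrightarrow> norm1 l) F"
  unfolding norm1_def by (intro tendsto_intros)

text \<open>With the signs frozen as weights, the norm is a linear functional that can be moved
  inside a mixture.\<close>

lemma norm1_eq_sum_sgn: "norm1 v = (\<Sum>y\<in>UNIV. sgn (v $ y) * v $ y)"
  by (simp add: norm1_def abs_sgn mult.commute)

lemma abs_sum_le_norm1:
  assumes "\<And>i. \<bar>w i\<bar> \<le> B"
  shows "\<bar>\<Sum>i\<in>UNIV. w i * z $ i\<bar> \<le> B * norm1 z"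
proof -
  have "\<bar>\<Sum>i\<in>UNIV. w i * z $ i\<bar> \<le> (\<Sum>i\<in>UNIV. \<bar>w i * z $ i\<bar>)"
    by (rule sum_abs)
  also have "\<dots> \<le> (\<Sum>i\<in>UNIV. B * \<bar>z $ i\<bar>)"
    using assms by (intro sum_mono) (simp add: abs_mult mult_right_mono)
  finally show ?thesis
    by (simp add: norm1_def sum_distrib_left)
qed

text \<open>Since \<open>z\<close> has total mass 0, \<open>w\<close> may be centred at the midpoint of its range.\<close>
lemma abs_sum_le_oscillation:
  fixes z :: "real ^ 'e::finite"
  assumes osc: "\<And>i j. \<bar>w i - w j\<bar> \<le> D" and z: "(\<Sum>i\<in>UNIV. z $ i) = 0"
  shows "\<bar>\<Sum>i\<in>UNIV. w i * z $ i\<bar> \<le> D / 2 * norm1 z"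
proof -
  have "Min (range w) \<in> range w" "Max (range w) \<in> range w"
    by (intro Min_in Max_in; simp)+
  then obtain i j where "w i = Min (range w)" "w j = Max (range w)"
    by (metis rangeE)
  then have i: "w i \<le> w k" and j: "w k \<le> w j" for k
    by simp_all
  define m where "m = (w i + w j) / 2"
  have "\<bar>w k - m\<bar> \<le> D / 2" for k
    using i[of k] j[of k] osc[of i j] unfolding m_def by (simp add: abs_le_iff field_simps)
  then have "\<bar>\<Sum>k\<in>UNIV. (w k - m) * z $ k\<bar> \<le> D / 2 * norm1 z"
    by (rule abs_sum_le_norm1)
  moreover have "(\<Sum>k\<in>UNIV. (w k - m) * z $ k) = (\<Sum>k\<in>UNIV. w k * z $ k)"
    by (simp add: left_diff_distrib sum_subtractf z flip: sum_distrib_left)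
  ultimately show ?thesis
    by simp
qed

section \<open>Mixtures of probability vectors and their contraction in the 1-norm\<close>

definition mix :: "('e::finite \<Rightarrow> real ^ 'f::finite) \<Rightarrow> real ^ 'e \<Rightarrow> real ^ 'f" where
  "mix P w = (\<chi> y. \<Sum>i\<in>UNIV. P i $ y * w $ i)"

lemma mean_kernel_eq_mix: "mean_kernel p x u \<mu> = mix (\<lambda>a. p x a \<mu>) u"
  by (simp add: mean_kernel_def mix_def)

lemma mix_diff_right: "mix P w - mix P w' = mix P (w - w')"
  by (simp add: mix_def vec_eq_iff right_diff_distrib sum_subtractf)

lemma mix_diff_left: "mix P w - mix P' w = mix (\<lambda>i. P i - P' i) w"
  by (simp add: mix_def vec_eq_iff left_diff_distrib sum_subtractf)

lemma sum_weights_mix: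
  "(\<Sum>y\<in>UNIV. s y * mix P w $ y) = (\<Sum>i\<in>UNIV. (\<Sum>y\<in>UNIV. s y * P i $ y) * w $ i)"
  by (simp add: mix_def sum_distrib_left sum_distrib_right mult.assoc) (rule sum.swap)

lemma mix_in_prob_simplex:
  assumes "\<And>i. P i \<in> prob_simplex" "w \<in> prob_simplex"
  shows "mix P w \<in> prob_simplex"
  using sum_weights_mix[of "\<lambda>_. 1" P w] assms
  by (auto simp: prob_simplex_def mix_def intro!: sum_nonneg)

lemma norm1_mix_le:
  assumes "\<And>i. norm1 (P i) \<le> B"
  shows "norm1 (mix P w) \<le> B * norm1 w"
proof -
  have "norm1 (mix P w) = (\<Sum>i\<in>UNIV. (\<Sum>y\<in>UNIV. sgn (mix P w $ y) * P i $ y) * w $ i)"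
    by (simp add: norm1_eq_sum_sgn sum_weights_mix)
  also have "\<dots> \<le> B * norm1 w"
  proof (rule order_trans[OF abs_ge_self abs_sum_le_norm1])
    fix i
    have "\<bar>\<Sum>y\<in>UNIV. sgn (mix P w $ y) * P i $ y\<bar> \<le> 1 * norm1 (P i)"
      by (rule abs_sum_le_norm1) (simp add: sgn_if)
    then show "\<bar>\<Sum>y\<in>UNIV. sgn (mix P w $ y) * P i $ y\<bar> \<le> B"
      using assms[of i] by simp
  qed
  finally show ?thesis .
qed

text \<open>Dobrushin contraction: testing the vectors \<open>P i\<close> against the signs of the
  mixture gives scalars of oscillation at most \<open>D\<close>, and since \<open>z\<close> has mass
  0 only half of it counts.\<close>

lemma norm1_mix_le_oscillation:
  assumes osc: "\<And>i j. norm1 (P i - P j) \<le> D" and z: "(\<Sum>i\<in>UNIV. z $ i) = 0"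
  shows "norm1 (mix P z) \<le> D / 2 * norm1 z"
proof -
  have "norm1 (mix P z) = (\<Sum>i\<in>UNIV. (\<Sum>y\<in>UNIV. sgn (mix P z $ y) * P i $ y) * z $ i)"
    by (simp add: norm1_eq_sum_sgn sum_weights_mix)
  also have "\<dots> \<le> D / 2 * norm1 z"
  proof (rule order_trans[OF abs_ge_self abs_sum_le_oscillation[OF _ z]])
    fix i j
    have "\<bar>\<Sum>y\<in>UNIV. sgn (mix P z $ y) * (P i - P j) $ y\<bar> \<le> 1 * norm1 (P i - P j)"
      by (rule abs_sum_le_norm1) (simp add: sgn_if)
    then show "\<bar>(\<Sum>y\<in>UNIV. sgn (mix P z $ y) * P i $ y) - (\<Sum>y\<in>UNIV. sgn (mix P z $ y) * P j $ y)\<bar> \<le> D"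
      using osc[of i j] by (simp add: right_diff_distrib sum_subtractf)
  qed
  finally show ?thesis .
qed

section \<open>A fixed point theorem for sequences of measures\<close>

text \<open>Banach's theorem for the metric \<open>SUP t. norm1 (m t - m' t) / s ^ t\<close>, with
  explicit bounds \<open>N\<close> in place of the supremum. All distances are at most 2, because
  the simplex has diameter at most 2 and \<open>s\<close> is at least 1. Limits are taken separately
  at each \<open>t\<close>.\<close>

lemma weighted_sequence_fixpoint:
  fixes F :: "(nat \<Rightarrow> real ^ 'e::finite) \<Rightarrow> nat \<Rightarrow> real ^ 'e"
  assumes s: "1 \<le> s" and \<alpha>: "0 \<le> \<alpha>" "\<alpha> < 1"
    and maps: "\<And>m t. \<forall>t. m t \<in> prob_simplex \<Longrightarrow> F m t \<in> prob_simplex"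
    and contr: "\<And>m m' N t. \<forall>t. m t \<in> prob_simplex \<Longrightarrow> \<forall>t. m' t \<in> prob_simplex \<Longrightarrow>
      \<forall>t. norm1 (m t - m' t) \<le> N * s ^ t \<Longrightarrow> norm1 (F m t - F m' t) \<le> \<alpha> * N * s ^ t"
  shows "\<exists>!m. (\<forall>t. m t \<in> prob_simplex) \<and> F m = m"
proof -
  have iter_in: "(F ^^ n) m t \<in> prob_simplex" if "\<forall>t. m t \<in> prob_simplex" for m n t
    using that by (induction n arbitrary: t) (auto intro: maps)
  have iter: "norm1 ((F ^^ n) m t - (F ^^ n) m' t) \<le> \<alpha> ^ n * 2 * s ^ t"
    if m: "\<forall>t. m t \<in> prob_simplex" "\<forall>t. m' t \<in> prob_simplex" for m m' n t
  proof (induction n arbitrary: t)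
    case 0
    have "norm1 (m t - m' t) \<le> 2 * 1"
      using m by (simp add: norm1_diff_le_2)
    also have "\<dots> \<le> 2 * s ^ t"
      using s by (intro mult_left_mono one_le_power) auto
    finally show ?case
      by simp
  next
    case (Suc n)
    then have "norm1 (F ((F ^^ n) m) t - F ((F ^^ n) m') t) \<le> \<alpha> * (\<alpha> ^ n * 2) * s ^ t"
      using iter_in m by (intro contr) auto
    then show ?case
      by simp
  qed
  have vanish: "(\<lambda>n. \<alpha> ^ n * 2 * s ^ t) \<longlonglongrightarrow> 0" for t
    using \<alpha> by (intro tendsto_mult_left_zero LIMSEQ_realpow_zero)
  obtain e :: "real ^ 'e" where e: "e \<in> prob_simplex"
    using prob_simplex_nonempty by blast
  define a where "a n = (F ^^ n) (\<lambda>_. e)" for n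
  have a_in: "\<forall>t. a n t \<in> prob_simplex" for n
    using iter_in e by (simp add: a_def)
  \<comment> \<open>\<open>a (n + k)\<close> is the \<open>n\<close>-th iterate of
    \<open>a k\<close>, so the bound for two arbitrary starting sequences applies, uniformly in
    \<open>k\<close>.\<close>
  have a_close: "norm1 (a (n + k) t - a n t) \<le> \<alpha> ^ n * 2 * s ^ t" for n k t
    using iter[of "a k" "\<lambda>_. e" n t] e a_in by (simp add: a_def funpow_add)
  have "Cauchy (\<lambda>n. a n t)" for t
    unfolding Cauchy_altdef2
  proof (intro allI impI)
    fix \<epsilon> :: real
    assume "0 < \<epsilon>"
    then obtain n where n: "\<alpha> ^ n * 2 * s ^ t < \<epsilon>"
      using order_tendstoD(2)[OF vanish, of \<epsilon> t] eventually_happens'[OF sequentially_bot] by blast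
    have "dist (a m t) (a n t) < \<epsilon>" if "n \<le> m" for m
      using norm_le_norm1[of "a m t - a n t"] a_close[of n "m - n" t] that n
      by (simp add: dist_norm)
    then show "\<exists>n. \<forall>m\<ge>n. dist (a m t) (a n t) < \<epsilon>"
      by blast
  qed
  then obtain l where l: "\<And>t. (\<lambda>n. a n t) \<longlonglongrightarrow> l t"
    unfolding Cauchy_convergent_iff convergent_def by metis
  have l_in: "\<forall>t. l t \<in> prob_simplex"
    using closed_sequentially[OF closed_prob_simplex _ l] a_in by blast
  have l_close: "norm1 (l t - a n t) \<le> \<alpha> ^ n * 2 * s ^ t" for n t
  proof (rule tendsto_upperbound)
    have "(\<lambda>k. a (k + n) t) \<longlonglongrightarrow> l t"
      using l by (rule LIMSEQ_ignore_initial_segment)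
    then show "(\<lambda>k. norm1 (a (k + n) t - a n t)) \<longlonglongrightarrow> norm1 (l t - a n t)"
      by (intro tendsto_norm1 tendsto_intros)
  qed (use a_close[of n _ t] in \<open>simp_all add: add.commute[of n]\<close>)
  have "F l = l"
  proof
    fix t
    \<comment> \<open>Applying \<open>F\<close> to the pair \<open>l\<close>, \<open>a n\<close>
      shows that the iterates converge to \<open>F l\<close> as well as to \<open>l\<close>.\<close>
    have "norm1 (F l t - a (Suc n) t) \<le> \<alpha> * (\<alpha> ^ n * 2) * s ^ t" for n
      using contr[OF l_in a_in, of n "\<alpha> ^ n * 2" t] l_close by (simp add: a_def)
    then have "norm (F l t - a (Suc n) t) \<le> \<alpha> ^ Suc n * 2 * s ^ t" for n
      by (metis norm_le_norm1 order_trans power_Suc mult.assoc)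
    then have "(\<lambda>n. F l t - a (Suc n) t) \<longlonglongrightarrow> 0"
      by (intro Lim_null_comparison[OF _ LIMSEQ_Suc[OF vanish]] always_eventually allI)
    then have "(\<lambda>n. F l t - (F l t - a (Suc n) t)) \<longlonglongrightarrow> F l t - 0"
      by (intro tendsto_intros)
    then show "F l t = l t"
      using LIMSEQ_unique[OF _ LIMSEQ_Suc[OF l]] by simp
  qed
  moreover have "m = m'"
    if "\<forall>t. m t \<in> prob_simplex" "F m = m" "\<forall>t. m' t \<in> prob_simplex" "F m' = m'" for m m'
  proof
    fix t
    have "(F ^^ n) m = m" "(F ^^ n) m' = m'" for n
      using that by (induction n) auto
    then have "norm1 (m t - m' t) \<le> \<alpha> ^ n * 2 * s ^ t" for n
      using iter[of m m' n t] that by simp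
    then have "norm1 (m t - m' t) \<le> 0"
      by (intro tendsto_lowerbound[OF vanish] always_eventually allI) auto
    then show "m t = m' t"
      using order_trans[OF norm_le_norm1] by (metis eq_iff_diff_eq_0 norm_le_zero_iff)
  qed
  ultimately show ?thesis
    using l_in by (intro ex1I[of _ l] conjI) blast+
qed

section \<open>Point masses on the simplex\<close>

lemma space_simplex_borel: "space simplex_borel = prob_simplex"
  by (simp add: simplex_borel_def space_restrict_space)

lemma singleton_in_simplex_borel:
  assumes "u \<in> prob_simplex"
  shows "{u} \<in> sets simplex_borel"
  using assms by (auto simp: simplex_borel_def sets_restrict_space intro!: image_eqI[of _ _ "{u}"])

text \<open>Every measurable set has mass 1 or 0 according to whether it contains \<open>u\<close>.
  This turns the support condition on policies into an equation.\<close>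

lemma eq_return_if_AE:
  assumes M: "M \<in> space (prob_algebra simplex_borel)" and ae: "AE v in M. v = u"
    and u: "u \<in> prob_simplex"
  shows "M = return simplex_borel u"
proof -
  interpret prob_space M
    using M by (simp add: space_prob_algebra)
  have sets: "sets M = sets simplex_borel"
    using M by (simp add: space_prob_algebra)
  show ?thesis
  proof (rule measure_eqI)
    fix A
    assume A: "A \<in> sets M"
    show "emeasure M A = emeasure (return simplex_borel u) A"
    proof (cases "u \<in> A")
      case True
      then have "AE v in M. v \<in> A"
        using ae by auto
      then have "emeasure M A = 1"
        using A by (simp add: emeasure_eq_1_AE)
      then show ?thesis
        using True A sets by simp
    next
      case False
      then have "AE v in M. v \<notin> A"
        using ae by auto
      then have "emeasure M A = 0"
        using A by (simp add: AE_iff_measurable[of A M] sets.sets_into_space subsetD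
            Collect_conj_eq inf.absorb2 Int_absorb1)
      then show ?thesis
        using False A sets by simp
    qed
  qed (simp add: sets)
qed

lemma return_in_prob_algebra:
  assumes "u \<in> prob_simplex"
  shows "return simplex_borel u \<in> space (prob_algebra simplex_borel)"
  using assms by (simp add: space_prob_algebra prob_space_return space_simplex_borel)

lemma AE_return_simplex:
  assumes "u \<in> prob_simplex"
  shows "AE v in return simplex_borel u. v = u"
proof -
  have "{v \<in> space simplex_borel. v = u} = {u}"
    using assms by (auto simp: space_simplex_borel)
  then have "Measurable.pred simplex_borel (\<lambda>v. v = u)"
    using singleton_in_simplex_borel[OF assms] by (simp add: pred_def)
  then show ?thesis
    using assms by (simp add: AE_return space_simplex_borel)
qed

lemma H2_return:
  assumes "\<And>x. u x \<in> prob_simplex"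
  shows "H2 p (\<lambda>x. return simplex_borel (u x)) \<mu> = mix (\<lambda>x. mean_kernel p x (u x) \<mu>) \<mu>"
proof -
  have "(\<lambda>v. mean_kernel p x v \<mu> $ y) \<in> borel_measurable simplex_borel" for x y
    unfolding simplex_borel_def mean_kernel_def
    by (intro measurable_restrict_space1 borel_measurable_continuous_onI)
      (simp, intro continuous_intros)
  then have "(\<integral>v. mean_kernel p x v \<mu> $ y \<partial>return simplex_borel (u x)) = mean_kernel p x (u x) \<mu> $ y"
    for x y
    using assms by (simp add: integral_return space_simplex_borel)
  then show ?thesis
    by (simp add: H2_def mix_def)
qed

section \<open>The regularized model\<close>

text \<open>\<open>L\<close> is the paper's \<open>L1 / (1 - \<beta> * K1 / 2)\<close>.\<close>
locale regularized_model =
  fixes c :: "'x::finite \<Rightarrow> 'a::finite \<Rightarrow> real ^ 'x \<Rightarrow> real"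
    and p :: "'x \<Rightarrow> 'a \<Rightarrow> real ^ 'x \<Rightarrow> real ^ 'x"
    and \<Omega> :: "real ^ 'a \<Rightarrow> real"
    and \<beta> \<rho> L1 K1 L :: real
  assumes beta: "0 < \<beta>" "\<beta> < 1"
    and rho: "0 < \<rho>"
    and kernel: "transition_kernel p"
    and convex: "strongly_convex1 \<Omega>"
    and minimizers: "unique_minimizers \<rho> \<Omega>"
    and lipschitz: "lipschitz_model c p L1 K1"
    and K1: "0 \<le> K1"
    and L: "0 \<le> L" "L = L1 + \<beta> * (L / 2 * K1)"
begin

section \<open>Lipschitz bounds for the averaged kernels\<close>

lemma kernel_lipschitz:
  assumes "\<mu> \<in> prob_simplex" "\<mu>' \<in> prob_simplex"
  shows "norm1 (p x a \<mu> - p x' a' \<mu>')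
    \<le> K1 * (of_bool (x \<noteq> x') + 2 * of_bool (a \<noteq> a') + norm1 (\<mu> - \<mu>'))"
  using lipschitz assms unfolding lipschitz_model_def by blast

lemma cost_lipschitz:
  assumes "\<mu> \<in> prob_simplex" "\<mu>' \<in> prob_simplex"
  shows "\<bar>c x a \<mu> - c x' a' \<mu>'\<bar>
    \<le> L1 * (of_bool (x \<noteq> x') + 2 * of_bool (a \<noteq> a') + norm1 (\<mu> - \<mu>'))"
  using lipschitz assms unfolding lipschitz_model_def by blast

lemma kernel_in_prob_simplex: "\<mu> \<in> prob_simplex \<Longrightarrow> p x a \<mu> \<in> prob_simplex"
  using kernel by (simp add: transition_kernel_def)

lemma mean_kernel_in_prob_simplex:
  "\<mu> \<in> prob_simplex \<Longrightarrow> u \<in> prob_simplex \<Longrightarrow> mean_kernel p x u \<mu> \<in> prob_simplex"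
  by (simp add: mean_kernel_eq_mix mix_in_prob_simplex kernel_in_prob_simplex)

text \<open>First \<open>u\<close> is changed, then \<open>x\<close> and \<mu>. Distinct actions
  change the kernel by at most \<open>2 * K1\<close>, which the oscillation bound halves, so
  \<open>u\<close> enters with weight \<open>K1\<close>.\<close>

lemma mean_kernel_lipschitz:
  assumes \<mu>: "\<mu> \<in> prob_simplex" "\<mu>' \<in> prob_simplex" and u: "u \<in> prob_simplex" "u' \<in> prob_simplex"
  shows "norm1 (mean_kernel p x u \<mu> - mean_kernel p x' u' \<mu>')
    \<le> K1 * (of_bool (x \<noteq> x') + norm1 (u - u') + norm1 (\<mu> - \<mu>'))"
proof -
  have "norm1 (p x a \<mu> - p x b \<mu>) \<le> 2 * K1" for a b
    using kernel_lipschitz[OF \<mu>(1) \<mu>(1), of x a x b] K1 by (cases "a = b") auto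
  then have 1: "norm1 (mix (\<lambda>a. p x a \<mu>) (u - u')) \<le> 2 * K1 / 2 * norm1 (u - u')"
    using u by (intro norm1_mix_le_oscillation) (simp_all add: sum_subtractf prob_simplex_sum)
  have "norm1 (p x a \<mu> - p x' a \<mu>') \<le> K1 * (of_bool (x \<noteq> x') + norm1 (\<mu> - \<mu>'))" for a
    using kernel_lipschitz[OF \<mu>, of x a x' a] by simp
  then have 2: "norm1 (mix (\<lambda>a. p x a \<mu> - p x' a \<mu>') u')
      \<le> K1 * (of_bool (x \<noteq> x') + norm1 (\<mu> - \<mu>')) * norm1 u'"
    by (rule norm1_mix_le)
  have "mean_kernel p x u \<mu> - mean_kernel p x' u' \<mu>'
      = mix (\<lambda>a. p x a \<mu>) (u - u') + mix (\<lambda>a. p x a \<mu> - p x' a \<mu>') u'"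
    by (simp add: mean_kernel_eq_mix flip: mix_diff_right mix_diff_left)
  then show ?thesis
    using 1 2 norm1_triangle[of "mix (\<lambda>a. p x a \<mu>) (u - u')" "mix (\<lambda>a. p x a \<mu> - p x' a \<mu>') u'"] u
    by (simp add: norm1_prob_simplex algebra_simps)
qed

text \<open>The minimum bounds the effect of changing the mixing measure under fixed kernels: 1
  because each has norm 1, \<open>3 / 2 * K1\<close> because two of them differ by at most
  \<open>K1 * (1 + 2)\<close>, halved by the oscillation bound. The other \<open>K1\<close> comes
  from the dependence of the kernels on the measure.\<close>

lemma mix_mean_kernel_lipschitz:
  assumes \<mu>: "\<mu> \<in> prob_simplex" "\<mu>' \<in> prob_simplex"
    and u: "\<And>x. u x \<in> prob_simplex" "\<And>x. u' x \<in> prob_simplex"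
    and e: "\<And>x. norm1 (u x - u' x) \<le> e"
  shows "norm1 (mix (\<lambda>x. mean_kernel p x (u x) \<mu>) \<mu> - mix (\<lambda>x. mean_kernel p x (u' x) \<mu>') \<mu>')
    \<le> (K1 + min 1 (3 / 2 * K1)) * norm1 (\<mu> - \<mu>') + K1 * e"
proof -
  let ?P = "\<lambda>x. mean_kernel p x (u x) \<mu>" and ?P' = "\<lambda>x. mean_kernel p x (u' x) \<mu>'"
  have "norm1 (?P x - ?P y) \<le> 3 * K1" for x y
  proof -
    have "norm1 (?P x - ?P y) \<le> K1 * (of_bool (x \<noteq> y) + norm1 (u x - u y) + norm1 (\<mu> - \<mu>))"
      using \<mu> u by (intro mean_kernel_lipschitz)
    also have "\<dots> \<le> K1 * (1 + 2 + 0)"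
      using K1 norm1_diff_le_2[OF u(1)[of x] u(1)[of y]] by (intro mult_left_mono add_mono) auto
    finally show ?thesis
      by simp
  qed
  then have "norm1 (mix ?P (\<mu> - \<mu>')) \<le> 3 * K1 / 2 * norm1 (\<mu> - \<mu>')"
    using \<mu> by (intro norm1_mix_le_oscillation) (simp_all add: sum_subtractf prob_simplex_sum)
  moreover have "norm1 (mix ?P (\<mu> - \<mu>')) \<le> 1 * norm1 (\<mu> - \<mu>')"
    using \<mu> u by (intro norm1_mix_le) (simp add: norm1_prob_simplex mean_kernel_in_prob_simplex)
  ultimately have 1: "norm1 (mix ?P (\<mu> - \<mu>')) \<le> min 1 (3 / 2 * K1) * norm1 (\<mu> - \<mu>')"
    by (simp add: min_def)
  have "norm1 (?P x - ?P' x) \<le> K1 * (e + norm1 (\<mu> - \<mu>'))" for x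
  proof -
    have "norm1 (?P x - ?P' x) \<le> K1 * (of_bool (x \<noteq> x) + norm1 (u x - u' x) + norm1 (\<mu> - \<mu>'))"
      using \<mu> u by (intro mean_kernel_lipschitz)
    also have "\<dots> \<le> K1 * (e + norm1 (\<mu> - \<mu>'))"
      using K1 e[of x] by (intro mult_left_mono) auto
    finally show ?thesis .
  qed
  then have 2: "norm1 (mix (\<lambda>x. ?P x - ?P' x) \<mu>') \<le> K1 * (e + norm1 (\<mu> - \<mu>')) * norm1 \<mu>'"
    by (rule norm1_mix_le)
  have "mix ?P \<mu> - mix ?P' \<mu>' = mix ?P (\<mu> - \<mu>') + mix (\<lambda>x. ?P x - ?P' x) \<mu>'"
    by (simp flip: mix_diff_right mix_diff_left)
  then show ?thesis
    using 1 2 norm1_triangle[of "mix ?P (\<mu> - \<mu>')" "mix (\<lambda>x. ?P x - ?P' x) \<mu>'"] \<mu>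
    by (simp add: norm1_prob_simplex algebra_simps)
qed

section \<open>Regularized minimization over the action simplex\<close>

definition reg :: "('a \<Rightarrow> real) \<Rightarrow> real ^ 'a \<Rightarrow> real" where
  "reg q u = (\<Sum>a\<in>UNIV. q a * u $ a) + \<rho> * \<Omega> u"

definition argmin :: "('a \<Rightarrow> real) \<Rightarrow> real ^ 'a" where
  "argmin q = (THE u. minimizer (reg q) u)"

lemma minimizer_iff: "minimizer (reg q) u \<longleftrightarrow> u = argmin q"
proof -
  have "\<exists>!u. minimizer (reg q) u"
    using minimizers unfolding unique_minimizers_def reg_def by blast
  then show ?thesis
    unfolding argmin_def by (metis theI')
qed

lemma argmin_in: "argmin q \<in> prob_simplex"
  and argmin_le: "v \<in> prob_simplex \<Longrightarrow> reg q (argmin q) \<le> reg q v"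
  using minimizer_iff[of q "argmin q"] by (auto simp: is_arg_min_linorder)

lemma reg_strongly_convex:
  assumes "u \<in> prob_simplex" "v \<in> prob_simplex" "0 \<le> \<theta>" "\<theta> \<le> 1"
  shows "reg q (\<theta> *\<^sub>R u + (1 - \<theta>) *\<^sub>R v)
    \<le> \<theta> * reg q u + (1 - \<theta>) * reg q v - \<rho> / 2 * \<theta> * (1 - \<theta>) * (norm1 (u - v))\<^sup>2"
proof -
  have "\<Omega> (\<theta> *\<^sub>R u + (1 - \<theta>) *\<^sub>R v)
      \<le> \<theta> * \<Omega> u + (1 - \<theta>) * \<Omega> v - 1 / 2 * \<theta> * (1 - \<theta>) * (norm1 (u - v))\<^sup>2"
    using convex assms unfolding strongly_convex1_def by (metis atLeastAtMost_iff)
  then have "\<rho> * \<Omega> (\<theta> *\<^sub>R u + (1 - \<theta>) *\<^sub>R v)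
      \<le> \<rho> * (\<theta> * \<Omega> u + (1 - \<theta>) * \<Omega> v - 1 / 2 * \<theta> * (1 - \<theta>) * (norm1 (u - v))\<^sup>2)"
    using rho by (intro mult_left_mono) auto
  moreover have "(\<Sum>a\<in>UNIV. q a * (\<theta> *\<^sub>R u + (1 - \<theta>) *\<^sub>R v) $ a)
      = \<theta> * (\<Sum>a\<in>UNIV. q a * u $ a) + (1 - \<theta>) * (\<Sum>a\<in>UNIV. q a * v $ a)"
    by (simp add: sum_distrib_left algebra_simps flip: sum.distrib)
  ultimately show ?thesis
    unfolding reg_def by (simp only:) (simp add: algebra_simps)
qed

text \<open>The minimal value is at most the value at a convex combination; the strong convexity
  inequality is then divided by \<open>1 - \<theta>\<close>. The constant \<open>\<rho> / 2\<close>
  is approached as \<theta> tends to 1.\<close>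

lemma reg_growth:
  assumes v: "v \<in> prob_simplex" and \<theta>: "0 < \<theta>" "\<theta> < 1"
  shows "reg q (argmin q) + \<rho> / 2 * \<theta> * (norm1 (argmin q - v))\<^sup>2 \<le> reg q v"
proof -
  let ?u = "argmin q"
  have "\<theta> *\<^sub>R ?u + (1 - \<theta>) *\<^sub>R v \<in> prob_simplex"
    using argmin_in[of q] v \<theta>
    by (auto simp: prob_simplex_def sum.distrib simp flip: sum_distrib_left)
  then have "reg q ?u \<le> \<theta> * reg q ?u + (1 - \<theta>) * reg q v - \<rho> / 2 * \<theta> * (1 - \<theta>) * (norm1 (?u - v))\<^sup>2"
    using order_trans[OF argmin_le reg_strongly_convex[OF argmin_in v]] \<theta> by simp
  then have "(1 - \<theta>) * (reg q ?u + \<rho> / 2 * \<theta> * (norm1 (?u - v))\<^sup>2) \<le> (1 - \<theta>) * reg q v"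
    by (simp add: algebra_simps)
  then show ?thesis
    using \<theta> by simp
qed

text \<open>In the sum of the growth inequalities at both minimizers \<Omega> cancels, leaving the
  pairing of \<open>q - q'\<close> with their difference, which is at most \<epsilon> times their
  distance. One factor of the distance is divided out, and \<theta> tends to 1.\<close>

lemma argmin_lipschitz:
  assumes \<epsilon>: "\<And>a. \<bar>q a - q' a\<bar> \<le> \<epsilon>"
  shows "norm1 (argmin q - argmin q') \<le> \<epsilon> / \<rho>"
proof (cases "norm1 (argmin q - argmin q') = 0")
  case True
  have "0 \<le> \<epsilon>"
    using \<epsilon> abs_ge_zero order_trans by blast
  then show ?thesis
    using True rho by simp
next
  case False
  let ?u = "argmin q" and ?u' = "argmin q'"
  let ?n = "norm1 (?u - ?u')"
  have pos: "0 < ?n"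
    using False norm1_nonneg[of "?u - ?u'"] by simp
  have "\<theta> * (\<rho> * ?n) \<le> \<epsilon>" if \<theta>: "0 < \<theta>" "\<theta> < 1" for \<theta>
  proof -
    have "reg q ?u + \<rho> / 2 * \<theta> * ?n\<^sup>2 \<le> reg q ?u'"
      using argmin_in \<theta> by (rule reg_growth)
    moreover have "reg q' ?u' + \<rho> / 2 * \<theta> * ?n\<^sup>2 \<le> reg q' ?u"
      using reg_growth[OF argmin_in \<theta>, of q' q] by (simp add: norm1_minus_commute)
    moreover have "reg q ?u' - reg q ?u + reg q' ?u - reg q' ?u'
        = (\<Sum>a\<in>UNIV. (q a - q' a) * (?u' - ?u) $ a)"
      by (simp add: reg_def algebra_simps sum.distrib sum_subtractf)
    moreover have "\<bar>\<Sum>a\<in>UNIV. (q a - q' a) * (?u' - ?u) $ a\<bar> \<le> \<epsilon> * norm1 (?u' - ?u)"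
      using \<epsilon> by (rule abs_sum_le_norm1)
    ultimately have "(\<theta> * (\<rho> * ?n)) * ?n \<le> \<epsilon> * ?n"
      by (simp add: norm1_minus_commute[of ?u'] power2_eq_square algebra_simps)
    then show ?thesis
      using pos by simp
  qed
  then have "\<rho> * ?n \<le> \<epsilon>"
    by (rule field_le_mult_one_interval)
  then show ?thesis
    using rho by (simp add: field_simps)
qed

definition val :: "('a \<Rightarrow> real) \<Rightarrow> real" where
  "val q = reg q (argmin q)"

lemma val_eq_INF:
  assumes "\<And>v. v \<in> prob_simplex \<Longrightarrow> f v = reg q v"
  shows "(INF v\<in>prob_simplex. f v) = val q"
proof -
  have "(INF v\<in>prob_simplex. f v) = (INF v\<in>prob_simplex. reg q v)"
    using assms by (intro INF_cong) auto
  also have "\<dots> = val q"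
    unfolding val_def using argmin_in argmin_le by (intro cInf_eq_minimum) auto
  finally show ?thesis .
qed

text \<open>The minimizer for \<open>q'\<close> is a competitor for \<open>q\<close>, and
  \<open>\<rho> * \<Omega>\<close> cancels there.\<close>

lemma val_le:
  assumes "\<And>a. q a - q' a \<le> \<epsilon>"
  shows "val q - val q' \<le> \<epsilon>"
proof -
  let ?u = "argmin q'"
  have "val q - val q' \<le> reg q ?u - reg q' ?u"
    unfolding val_def using argmin_le[OF argmin_in] by simp
  also have "\<dots> = (\<Sum>a\<in>UNIV. (q a - q' a) * ?u $ a)"
    by (simp add: reg_def left_diff_distrib sum_subtractf)
  also have "\<dots> \<le> (\<Sum>a\<in>UNIV. \<epsilon> * ?u $ a)"
    using assms prob_simplex_nonneg[OF argmin_in] by (intro sum_mono mult_right_mono) auto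
  also have "\<dots> = \<epsilon>"
    by (simp add: prob_simplex_sum[OF argmin_in] flip: sum_distrib_left)
  finally show ?thesis .
qed

lemma val_lipschitz:
  assumes "\<And>a. \<bar>q a - q' a\<bar> \<le> \<epsilon>"
  shows "\<bar>val q - val q'\<bar> \<le> \<epsilon>"
  using val_le[of q q' \<epsilon>] val_le[of q' q \<epsilon>] assms by (auto simp: abs_le_iff)

section \<open>Bellman backups of Q-functions\<close>

definition backup :: "('x \<Rightarrow> 'a \<Rightarrow> real) \<Rightarrow> real ^ 'x \<Rightarrow> 'x \<Rightarrow> 'a \<Rightarrow> real" where
  "backup q \<mu> x a = c x a \<mu> + \<beta> * (\<Sum>y\<in>UNIV. val (q y) * p x a \<mu> $ y)"

text \<open>Costs and kernels are linear in \<open>u\<close>, so the recursion on functions over the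
  simplex reduces to one on finite tables \<open>q\<close>.\<close>

lemma H1_eq_reg_backup:
  assumes "\<And>x u. u \<in> prob_simplex \<Longrightarrow> Q x u = reg (q x) u"
  shows "H1 c p \<beta> \<rho> \<Omega> Q \<mu> x u = reg (backup q \<mu> x) u"
proof -
  have "(INF v\<in>prob_simplex. Q y v) = val (q y)" for y
    using assms by (rule val_eq_INF)
  moreover have "(\<Sum>a\<in>UNIV. \<beta> * (\<Sum>y\<in>UNIV. val (q y) * p x a \<mu> $ y) * u $ a)
      = \<beta> * (\<Sum>y\<in>UNIV. val (q y) * mean_kernel p x u \<mu> $ y)"
    unfolding mean_kernel_eq_mix sum_weights_mix by (simp add: sum_distrib_left mult_ac)
  ultimately show ?thesis
    by (simp add: H1_def reg_def backup_def mean_cost_def distrib_right sum.distrib)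
qed

definition lip :: "('x \<Rightarrow> 'a \<Rightarrow> real) \<Rightarrow> bool" where
  "lip q \<longleftrightarrow> (\<forall>x x' a a'. \<bar>q x a - q x' a'\<bar> \<le> L * (of_bool (x \<noteq> x') + 2 * of_bool (a \<noteq> a')))"

text \<open>Both the propagation of \<open>lip\<close> and the contraction estimate are instances of this bound; it
  is where the fixed point equation \<open>L = L1 + \<beta> * (L / 2 * K1)\<close> is used.\<close>
lemma backup_lipschitz:
  assumes q: "lip q" and \<epsilon>: "\<And>x a. \<bar>q x a - q' x a\<bar> \<le> \<epsilon>"
    and \<mu>: "\<mu> \<in> prob_simplex" "\<mu>' \<in> prob_simplex"
  shows "\<bar>backup q \<mu> x a - backup q' \<mu>' x' a'\<bar>
    \<le> L * (of_bool (x \<noteq> x') + 2 * of_bool (a \<noteq> a') + norm1 (\<mu> - \<mu>')) + \<beta> * \<epsilon>"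
proof -
  let ?d = "of_bool (x \<noteq> x') + 2 * of_bool (a \<noteq> a') + norm1 (\<mu> - \<mu>')"
  let ?P = "p x a \<mu>" and ?P' = "p x' a' \<mu>'"
  have "\<bar>val (q y) - val (q z)\<bar> \<le> L" for y z
  proof (rule val_lipschitz)
    fix b
    have "\<bar>q y b - q z b\<bar> \<le> L * of_bool (y \<noteq> z)"
      using q[unfolded lip_def, rule_format, of y b z b] by simp
    then show "\<bar>q y b - q z b\<bar> \<le> L"
      using L by (cases "y = z") auto
  qed
  then have "\<bar>\<Sum>y\<in>UNIV. val (q y) * (?P - ?P') $ y\<bar> \<le> L / 2 * norm1 (?P - ?P')"
    using kernel_in_prob_simplex \<mu>
    by (intro abs_sum_le_oscillation) (simp_all add: sum_subtractf prob_simplex_sum)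
  also have "\<dots> \<le> L / 2 * (K1 * ?d)"
    using L by (intro mult_left_mono kernel_lipschitz \<mu>) auto
  finally have 1: "\<bar>\<Sum>y\<in>UNIV. val (q y) * (?P - ?P') $ y\<bar> \<le> L / 2 * (K1 * ?d)" .
  have "\<bar>\<Sum>y\<in>UNIV. (val (q y) - val (q' y)) * ?P' $ y\<bar> \<le> \<epsilon> * norm1 ?P'"
    using \<epsilon> by (intro abs_sum_le_norm1 val_lipschitz)
  then have 2: "\<bar>\<Sum>y\<in>UNIV. (val (q y) - val (q' y)) * ?P' $ y\<bar> \<le> \<epsilon>"
    using \<mu> by (simp add: norm1_prob_simplex kernel_in_prob_simplex)
  \<comment> \<open>The change of kernel is tested against values of oscillation at most
    \<open>L\<close>; the change of values is averaged by one kernel and costs at most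
    \<epsilon>.\<close>
  have split: "backup q \<mu> x a - backup q' \<mu>' x' a' = (c x a \<mu> - c x' a' \<mu>')
      + \<beta> * ((\<Sum>y\<in>UNIV. val (q y) * (?P - ?P') $ y)
           + (\<Sum>y\<in>UNIV. (val (q y) - val (q' y)) * ?P' $ y))"
    by (simp add: backup_def algebra_simps sum.distrib sum_subtractf)
  have "\<bar>(\<Sum>y\<in>UNIV. val (q y) * (?P - ?P') $ y)
      + (\<Sum>y\<in>UNIV. (val (q y) - val (q' y)) * ?P' $ y)\<bar> \<le> L / 2 * (K1 * ?d) + \<epsilon>"
    using 1 2 by linarith
  then have "\<bar>\<beta> * ((\<Sum>y\<in>UNIV. val (q y) * (?P - ?P') $ y)
      + (\<Sum>y\<in>UNIV. (val (q y) - val (q' y)) * ?P' $ y))\<bar> \<le> \<beta> * (L / 2 * (K1 * ?d) + \<epsilon>)"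
    using beta by (simp only: abs_mult) (intro mult_mono, auto)
  then have "\<bar>backup q \<mu> x a - backup q' \<mu>' x' a'\<bar> \<le> L1 * ?d + \<beta> * (L / 2 * (K1 * ?d) + \<epsilon>)"
    unfolding split using cost_lipschitz[OF \<mu>, of x a x' a'] by linarith
  also have "\<dots> = (L1 + \<beta> * (L / 2 * K1)) * ?d + \<beta> * \<epsilon>"
    by (simp add: algebra_simps)
  finally show ?thesis
    using L by simp
qed

lemma lip_backup:
  assumes "lip q" "\<mu> \<in> prob_simplex"
  shows "lip (backup q \<mu>)"
  unfolding lip_def using backup_lipschitz[OF assms(1) _ assms(2) assms(2), of q 0] by simp

primrec qseq :: "('x \<Rightarrow> 'a \<Rightarrow> real) \<Rightarrow> (nat \<Rightarrow> real ^ 'x) \<Rightarrow> nat \<Rightarrow> 'x \<Rightarrow> 'a \<Rightarrow> real" where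
  "qseq q m 0 = q"
| "qseq q m (Suc t) = backup (qseq q m t) (m (Suc t))"

lemma lip_qseq:
  assumes "lip q" "\<forall>t. m t \<in> prob_simplex"
  shows "lip (qseq q m t)"
  using assms by (induction t) (auto intro: lip_backup)

lemma beta_mult_less_1: "0 < r \<Longrightarrow> r \<le> 1 \<Longrightarrow> \<beta> * r < 1"
  using beta mult_left_le[of r \<beta>] by linarith

text \<open>\<open>B = L / (1 - \<beta> * r)\<close> solves \<open>B = L + \<beta> * r * B\<close>:
  a new measure contributes \<open>L\<close>, while the inherited error is discounted by \<beta> and
  carries a weight smaller by the factor \<open>r\<close>.\<close>

lemma qseq_lipschitz:
  assumes q: "lip q" and m: "\<forall>t. m t \<in> prob_simplex" "\<forall>t. m' t \<in> prob_simplex"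
    and N: "\<forall>t. norm1 (m t - m' t) \<le> N * (1 / r) ^ t" and r: "0 < r" "r \<le> 1"
  shows "\<bar>qseq q m t x a - qseq q m' t x a\<bar> \<le> L / (1 - \<beta> * r) * N * (1 / r) ^ t"
proof (induction t arbitrary: x a)
  case 0
  have "0 \<le> N"
    using N[rule_format, of 0] norm1_nonneg[of "m 0 - m' 0"] by simp
  then show ?case
    using L beta_mult_less_1[OF r] by simp
next
  case (Suc t)
  let ?B = "L / (1 - \<beta> * r)"
  have br: "\<beta> * r < 1"
    using r by (rule beta_mult_less_1)
  have "\<bar>qseq q m (Suc t) x a - qseq q m' (Suc t) x a\<bar>
      \<le> L * norm1 (m (Suc t) - m' (Suc t)) + \<beta> * (?B * N * (1 / r) ^ t)"
    using backup_lipschitz[OF lip_qseq[OF q m(1)] Suc, of "m (Suc t)" "m' (Suc t)" x a x a] m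
    by simp
  also have "\<dots> \<le> L * (N * (1 / r) ^ Suc t) + \<beta> * (?B * N * (1 / r) ^ t)"
    using N[rule_format, of "Suc t"] L by (intro add_right_mono mult_left_mono) auto
  also have "(1 / r) ^ t = r * (1 / r) ^ Suc t"
    using r by simp
  also have "L * (N * (1 / r) ^ Suc t) + \<beta> * (?B * N * (r * (1 / r) ^ Suc t))
      = (L + \<beta> * r * ?B) * N * (1 / r) ^ Suc t"
    by (simp only: algebra_simps)
  also have "L + \<beta> * r * ?B = ?B"
    using br by (simp add: field_simps)
  finally show ?case .
qed

section \<open>The measure flow, its contraction and the equilibria\<close>

definition flow :: "('x \<Rightarrow> 'a \<Rightarrow> real) \<Rightarrow> (nat \<Rightarrow> real ^ 'x) \<Rightarrow> nat \<Rightarrow> real ^ 'x" where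
  "flow q m t = mix (\<lambda>x. mean_kernel p x (argmin (qseq q m (Suc t) x)) (m (Suc t))) (m (Suc t))"

lemma flow_in:
  assumes "\<forall>t. m t \<in> prob_simplex"
  shows "flow q m t \<in> prob_simplex"
  unfolding flow_def using assms argmin_in
  by (intro mix_in_prob_simplex mean_kernel_in_prob_simplex) auto

text \<open>Index \<open>t\<close> is generated from index \<open>Suc t\<close>, which costs the
  factor \<open>1 / r\<close>. The two summands are the direct dependence on the measure and the
  effect of the changed greedy actions.\<close>

lemma flow_contraction:
  assumes q: "lip q" and m: "\<forall>t. m t \<in> prob_simplex" "\<forall>t. m' t \<in> prob_simplex"
    and N: "\<forall>t. norm1 (m t - m' t) \<le> N * (1 / r) ^ t" and r: "0 < r" "r \<le> 1"
    and KD: "KD = K1 + min 1 (3 / 2 * K1)"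
  shows "norm1 (flow q m t - flow q m' t)
    \<le> (KD + L * K1 / \<rho> / (1 - \<beta> * r)) / r * N * (1 / r) ^ t"
proof -
  let ?e = "L / (1 - \<beta> * r) * N * (1 / r) ^ Suc t"
  have "norm1 (flow q m t - flow q m' t) \<le> KD * norm1 (m (Suc t) - m' (Suc t)) + K1 * (?e / \<rho>)"
    unfolding flow_def KD using m argmin_in
    by (intro mix_mean_kernel_lipschitz argmin_lipschitz qseq_lipschitz[OF q m N r]) auto
  also have "\<dots> \<le> KD * (N * (1 / r) ^ Suc t) + K1 * (?e / \<rho>)"
    using N[rule_format, of "Suc t"] K1 KD by (intro add_right_mono mult_left_mono) auto
  also have "\<dots> = (KD + L * K1 / \<rho> / (1 - \<beta> * r)) / r * N * (1 / r) ^ t"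
    by (simp add: distrib_right distrib_left add_divide_distrib mult_ac)
  finally show ?thesis .
qed

text \<open>Unique minimizers force the policies to be point masses, and induction on
  \<open>t\<close> forces the tables \<open>qseq q m\<close>. What remains is a fixed point equation
  for \<open>m\<close> alone.\<close>

lemma TRMFE_iff:
  assumes Q0: "\<forall>x. \<forall>u\<in>prob_simplex. Q0 x u = reg (q x) u"
  shows "(\<pi>, m) \<in> TRMFE c p \<beta> \<rho> \<Omega> Q0 \<longleftrightarrow>
    (\<forall>t. m t \<in> prob_simplex) \<and> flow q m = m \<and>
    \<pi> = (\<lambda>t x. return simplex_borel (argmin (qseq q m t x)))"
    (is "?L \<longleftrightarrow> ?R")
proof
  assume ?L
  then obtain Q where \<pi>: "\<And>t. \<pi> t \<in> policies" and m: "\<forall>t. m t \<in> prob_simplex"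
    and Q_0: "\<And>x u. u \<in> prob_simplex \<Longrightarrow> Q 0 x u = Q0 x u"
    and Q_Suc: "\<And>t x u. u \<in> prob_simplex \<Longrightarrow> Q (Suc t) x u = H1 c p \<beta> \<rho> \<Omega> (Q t) (m (Suc t)) x u"
    and m_eq: "\<And>t. m t = H2 p (\<pi> (Suc t)) (m (Suc t))"
    and ae: "\<And>t x. AE u in \<pi> t x. minimizer (Q t x) u"
    unfolding TRMFE_def mem_Collect_eq case_prod_conv by (elim exE conjE) (rule that; blast)
  have Q: "Q t x u = reg (qseq q m t x) u" if "u \<in> prob_simplex" for t x u
    using that
  proof (induction t arbitrary: x u)
    case (Suc t)
    show ?case
      unfolding Q_Suc[OF Suc.prems] qseq.simps by (rule H1_eq_reg_backup) (rule Suc.IH)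
  qed (simp add: Q_0 Q0)
  \<comment> \<open>\<open>is_arg_min\<close> compares only points of the simplex, where both
    functions agree.\<close>
  have "minimizer (Q t x) = minimizer (reg (qseq q m t x))" for t x
    using Q by (auto simp: fun_eq_iff is_arg_min_linorder)
  then have "AE u in \<pi> t x. u = argmin (qseq q m t x)" for t x
    using ae[of t x] by (simp add: minimizer_iff)
  then have \<pi>_eq: "\<pi> = (\<lambda>t x. return simplex_borel (argmin (qseq q m t x)))"
    using \<pi> argmin_in by (auto simp: fun_eq_iff policies_def intro!: eq_return_if_AE)
  have "flow q m t = m t" for t
    using m_eq[of t] argmin_in unfolding \<pi>_eq flow_def by (simp add: H2_return)
  then show ?R
    using m \<pi>_eq by auto
next
  assume R: ?R
  then have m: "\<forall>t. m t \<in> prob_simplex" and flow: "\<And>t. flow q m t = m t"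
    and \<pi>: "\<pi> = (\<lambda>t x. return simplex_borel (argmin (qseq q m t x)))"
    by auto
  have "\<forall>t. m t = H2 p (\<pi> (Suc t)) (m (Suc t))"
    using flow argmin_in unfolding \<pi> flow_def by (simp add: H2_return)
  moreover have "\<forall>t. \<pi> t \<in> policies \<and> m t \<in> prob_simplex"
    unfolding \<pi> policies_def using argmin_in m by (simp add: return_in_prob_algebra)
  moreover have "\<forall>t x. AE u in \<pi> t x. minimizer (reg (qseq q m t x)) u"
    unfolding \<pi> minimizer_iff by (intro allI AE_return_simplex argmin_in)
  moreover have "\<forall>t x. \<forall>u\<in>prob_simplex. reg (qseq q m (Suc t) x) u
      = H1 c p \<beta> \<rho> \<Omega> (\<lambda>x. reg (qseq q m t x)) (m (Suc t)) x u"
    by (simp add: H1_eq_reg_backup[OF refl])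
  moreover have "\<forall>x. \<forall>u\<in>prob_simplex. reg (qseq q m 0 x) u = Q0 x u"
    using Q0 by simp
  ultimately show ?L
    unfolding TRMFE_def mem_Collect_eq case_prod_conv 
    by (intro conjI exI[of _ "\<lambda>t x. reg (qseq q m t x)"]) assumption+
qed

text \<open>\<open>rate\<close> says that the factor in \<open>flow_contraction\<close> is below 1;
  the fixed point \<open>m\<close> then determines the policies.\<close>

lemma unique_TRMFE:
  assumes Q0: "\<forall>x. \<forall>u\<in>prob_simplex. Q0 x u = reg (q x) u" and q: "lip q"
    and KD: "KD = K1 + min 1 (3 / 2 * K1)"
    and r: "0 < r" "r \<le> 1" and rate: "L * K1 / \<rho> < (r - KD) * (1 - \<beta> * r)"
  shows "\<exists>!e. e \<in> TRMFE c p \<beta> \<rho> \<Omega> Q0"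
proof -
  define \<alpha> where "\<alpha> = (KD + L * K1 / \<rho> / (1 - \<beta> * r)) / r"
  have br: "\<beta> * r < 1"
    using r by (rule beta_mult_less_1)
  have "0 \<le> \<alpha>"
    unfolding \<alpha>_def KD using K1 L rho r br by (intro divide_nonneg_pos add_nonneg_nonneg) auto
  moreover have "L * K1 / \<rho> / (1 - \<beta> * r) < r - KD"
    using rate br by (simp only: pos_divide_less_eq diff_gt_0_iff_gt)
  then have "\<alpha> < 1"
    unfolding \<alpha>_def using r by simp
  ultimately have "\<exists>!m. (\<forall>t. m t \<in> prob_simplex) \<and> flow q m = m" (is "\<exists>!m. ?fix m")
    using r flow_in flow_contraction[OF q _ _ _ r KD, folded \<alpha>_def]
    by (intro weighted_sequence_fixpoint[where s = "1 / r" and \<alpha> = \<alpha>]) auto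
  then obtain m where m: "?fix m" "\<And>m'. ?fix m' \<Longrightarrow> m' = m"
    by blast
  show ?thesis
  proof (rule ex1I)
    show "(\<lambda>t x. return simplex_borel (argmin (qseq q m t x)), m) \<in> TRMFE c p \<beta> \<rho> \<Omega> Q0"
      using TRMFE_iff[OF Q0] m(1) by blast
    show "e = (\<lambda>t x. return simplex_borel (argmin (qseq q m t x)), m)"
      if "e \<in> TRMFE c p \<beta> \<rho> \<Omega> Q0" for e
    proof (cases e)
      case (Pair \<pi> m')
      then show ?thesis
        using TRMFE_iff[OF Q0, of \<pi> m'] that m(2)[of m'] by simp
    qed
  qed
qed

end

section \<open>The numerical conditions on the constants\<close>

text \<open>\<open>r\<close> maximizes the concave quadratic on the right-hand side over \<open>{0..1}\<close>: it is either the vertex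
  or 1.\<close>
lemma exists_rate:
  fixes \<beta> K \<kappa> :: real
  assumes beta: "0 < \<beta>" "\<beta> < 1" and K: "0 \<le> K" "K < 1" and \<kappa>: "0 \<le> \<kappa>"
    and small: "\<kappa> < \<beta> * (1 - K)\<^sup>2"
    and contraction: "sqrt \<beta> * (sqrt (K + \<kappa>) + sqrt \<kappa>) < 1"
  shows "\<exists>r. 0 < r \<and> r \<le> 1 \<and> \<kappa> < (r - K) * (1 - \<beta> * r)"
proof (cases "1 + \<beta> * K \<le> 2 * \<beta>")
  case True
  define a where "a = sqrt (\<beta> * (K + \<kappa>))"
  define b where "b = sqrt (\<beta> * \<kappa>)"
  \<comment> \<open>The vertex of the quadratic, which is at most 1 precisely in this case.\<close>
  define r where "r = (1 + \<beta> * K) / (2 * \<beta>)"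
  have ab: "0 \<le> a" "0 \<le> b" "a\<^sup>2 = \<beta> * (K + \<kappa>)" "b\<^sup>2 = \<beta> * \<kappa>"
    using beta K \<kappa> by (simp_all add: a_def b_def)
  \<comment> \<open>Squaring, with \<open>a\<^sup>2 - b\<^sup>2 = \<beta> * K\<close>, gives
    \<open>2 * b < 1 - \<beta> * K\<close>; a second squaring compares \<kappa> with the value
    \<open>(1 - \<beta> * K)\<^sup>2 / (4 * \<beta>)\<close> at the vertex.\<close>
  have "a < 1 - b"
    using contraction unfolding a_def b_def real_sqrt_mult by (simp add: distrib_left)
  then have "a\<^sup>2 < (1 - b)\<^sup>2"
    using ab by (intro power_strict_mono) auto
  then have "2 * b < 1 - \<beta> * K"
    using ab by (simp add: power2_eq_square algebra_simps)
  then have "(2 * b)\<^sup>2 < (1 - \<beta> * K)\<^sup>2"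
    using ab by (intro power_strict_mono) auto
  then have "4 * \<beta> * \<kappa> < (1 - \<beta> * K)\<^sup>2"
    using ab by (simp add: power_mult_distrib)
  moreover have "(r - K) * (1 - \<beta> * r) = (1 - \<beta> * K)\<^sup>2 / (4 * \<beta>)"
    using beta by (simp add: r_def field_simps power2_eq_square)
  moreover have "\<kappa> = 4 * \<beta> * \<kappa> / (4 * \<beta>)"
    using beta by simp
  ultimately have "\<kappa> < (r - K) * (1 - \<beta> * r)"
    using beta by (metis divide_strict_right_mono mult_pos_pos zero_less_numeral)
  moreover have "0 < r" "r \<le> 1"
    using beta K True by (auto simp: r_def intro!: divide_pos_pos add_pos_nonneg)
  ultimately show ?thesis
    by blast
next
  case False
  \<comment> \<open>The vertex exceeds 1, that is \<open>\<beta> * (1 - K) < 1 - \<beta>\<close>, so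
    \<open>small\<close> bounds \<kappa> by the value of the quadratic at 1.\<close>
  then have "\<beta> * (1 - K) * (1 - K) \<le> (1 - \<beta>) * (1 - K)"
    using K by (intro mult_right_mono) (auto simp: algebra_simps)
  then have "\<kappa> < (1 - K) * (1 - \<beta> * 1)"
    using small by (simp add: power2_eq_square algebra_simps)
  then show ?thesis
    by (intro exI[of _ 1]) auto
qed

text \<open>If \<open>X\<close> and \<open>A\<close> are both singletons, the Lipschitz assumption does not force \<open>L1\<close> and \<open>K1\<close> to
  be nonnegative.\<close>
lemma lipschitz_model_constants:
  fixes c :: "'x::finite \<Rightarrow> 'a::finite \<Rightarrow> real ^ 'x \<Rightarrow> real"
  assumes lipschitz: "lipschitz_model c p L1 K1"
    and nontrivial: "\<not> ((\<forall>x x' :: 'x. x = x') \<and> (\<forall>a a' :: 'a. a = a'))"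
  shows "0 \<le> L1" "0 \<le> K1"
proof -
  obtain x x' :: 'x and a a' :: 'a where ne: "x \<noteq> x' \<or> a \<noteq> a'"
    using nontrivial by blast
  obtain \<mu> :: "real ^ 'x" where \<mu>: "\<mu> \<in> prob_simplex"
    using prob_simplex_nonempty by blast
  let ?d = "of_bool (x \<noteq> x') + 2 * of_bool (a \<noteq> a') :: real"
  have "\<bar>c x a \<mu> - c x' a' \<mu>\<bar> \<le> L1 * ?d" "norm1 (p x a \<mu> - p x' a' \<mu>) \<le> K1 * ?d"
    using lipschitz \<mu> unfolding lipschitz_model_def
    by (metis add_0_right cancel_comm_monoid_add_class.diff_cancel norm1_zero)+
  then have "0 \<le> L1 * ?d" "0 \<le> K1 * ?d"
    using abs_ge_zero norm1_nonneg order_trans by blast+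
  moreover have "0 < ?d"
    using ne by auto
  ultimately show "0 \<le> L1" "0 \<le> K1"
    by (simp_all add: zero_le_mult_iff)
qed

text \<open>The simplex over a one-point state space is a single point, so all differences vanish.
  The zero constants replace \<open>L1\<close> and \<open>K1\<close>, which may be negative here,
  while the locale asks for nonnegative \<open>K1\<close> and \<open>L\<close>.\<close>

lemma lipschitz_model_trivial:
  fixes c :: "'x::finite \<Rightarrow> 'a::finite \<Rightarrow> real ^ 'x \<Rightarrow> real"
  assumes "\<forall>x x' :: 'x. x = x'" "\<forall>a a' :: 'a. a = a'"
  shows "lipschitz_model c p 0 0"
  unfolding lipschitz_model_def
proof (intro allI ballI)
  fix x x' :: 'x and a a' :: 'a and \<mu> \<mu>' :: "real ^ 'x"
  assume \<mu>: "\<mu> \<in> prob_simplex" "\<mu>' \<in> prob_simplex"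
  have "(\<Sum>i\<in>UNIV. m $ i) = m $ y" for m :: "real ^ 'x" and y
  proof -
    have "UNIV = {y}"
      using assms by blast
    then have "(\<Sum>i\<in>UNIV. m $ i) = (\<Sum>i\<in>{y}. m $ i)"
      by (rule arg_cong)
    then show ?thesis
      by simp
  qed
  then have "\<mu> = \<mu>'"
    using \<mu>[THEN prob_simplex_sum] by (metis vec_eq_iff)
  moreover have "x = x'" "a = a'"
    using assms by auto
  ultimately show "\<bar>c x a \<mu> - c x' a' \<mu>'\<bar>
      \<le> 0 * (of_bool (x \<noteq> x') + 2 * of_bool (a \<noteq> a') + norm1 (\<mu> - \<mu>')) \<and>
    norm1 (p x a \<mu> - p x' a' \<mu>')
      \<le> 0 * (of_bool (x \<noteq> x') + 2 * of_bool (a \<noteq> a') + norm1 (\<mu> - \<mu>'))"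
    by simp
qed

theorem theorem2:
  fixes c :: "'x::finite \<Rightarrow> 'a::finite \<Rightarrow> real ^ 'x \<Rightarrow> real"
    and p :: "'x \<Rightarrow> 'a \<Rightarrow> real ^ 'x \<Rightarrow> real ^ 'x"
    and \<Omega> :: "real ^ 'a \<Rightarrow> real"
    and \<beta> \<rho> L1 K1 Lbar KD :: real
  assumes beta: "0 < \<beta>" "\<beta> < 1"
    and rho: "\<rho> > 0"
    and cost: "\<forall>x a. \<forall>\<mu>\<in>prob_simplex. 0 \<le> c x a \<mu>"
    and kernel: "transition_kernel p"
    and convex: "strongly_convex1 \<Omega>"
    and minimizers: "unique_minimizers \<rho> \<Omega>"
    and lipschitz: "lipschitz_model c p L1 K1"
    and Lbar_eq: "Lbar = L1 / (1 - \<beta> * K1 / 2)"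
    and KD_eq: "KD = K1 + min 1 (3 / 2 * K1)"
    and KD_less: "KD < 1"
    and small: "Lbar * K1 / \<rho> < \<beta> * (1 - KD)\<^sup>2"
    and contraction: "sqrt \<beta> * (sqrt (KD + Lbar * K1 / \<rho>) + sqrt (Lbar * K1 / \<rho>)) < 1"
  shows "\<forall>Q_terminal \<in> C_reg c L1 K1 \<beta> \<rho> \<Omega>. \<exists>!e. e \<in> TRMFE c p \<beta> \<rho> \<Omega> Q_terminal"
proof
  fix Q0
  assume "Q0 \<in> C_reg c L1 K1 \<beta> \<rho> \<Omega>"
  then obtain q where Q0: "\<forall>x. \<forall>u\<in>prob_simplex. Q0 x u = (\<Sum>a\<in>UNIV. q x a * u $ a) + \<rho> * \<Omega> u"
    and q: "\<forall>x x' a a'. \<bar>q x a - q x' a'\<bar> \<le> Lbar * (of_bool (x \<noteq> x') + 2 * of_bool (a \<noteq> a'))"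
    unfolding C_reg_def C_tilde_def Lbar_eq[symmetric] by (elim CollectE bexE conjE) (rule that)
  show "\<exists>!e. e \<in> TRMFE c p \<beta> \<rho> \<Omega> Q0"
  proof (cases "(\<forall>x x' :: 'x. x = x') \<and> (\<forall>a a' :: 'a. a = a')")
    case True
    \<comment> \<open>With all constants 0, \<open>KD\<close> is 0 and \<open>r = 1\<close>
      satisfies the rate condition.\<close>
    interpret regularized_model c p \<Omega> \<beta> \<rho> 0 0 0
      using beta rho kernel convex minimizers lipschitz_model_trivial True
      by unfold_locales auto
    show ?thesis
    proof (rule unique_TRMFE)
      show "lip q"
        using True unfolding lip_def by (metis abs_zero diff_self mult_zero_left order_refl)
      show "0 * 0 / \<rho> < (1 - 0) * (1 - \<beta> * 1)"
        using beta by simp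
    qed (use Q0 in \<open>auto simp: reg_def\<close>)
  next
    case False
    have nonneg: "0 \<le> L1" "0 \<le> K1"
      using lipschitz_model_constants[OF lipschitz False] by auto
    \<comment> \<open>\<open>KD\<close> dominates \<open>K1\<close>, so the denominator of
      \<open>Lbar\<close> is positive and \<open>Lbar\<close> solves the fixed point equation
      required by the locale.\<close>
    have "K1 < 1"
      using KD_eq KD_less nonneg by (auto simp: min_def split: if_splits)
    then have "\<beta> * K1 < 1"
      using beta mult_left_le[of K1 \<beta>] by linarith
    then have pos: "0 < 1 - \<beta> * K1 / 2"
      by simp
    then have Lbar: "0 \<le> Lbar" "Lbar = L1 + \<beta> * (Lbar / 2 * K1)"
      using nonneg by (simp_all add: Lbar_eq field_simps)
    interpret regularized_model c p \<Omega> \<beta> \<rho> L1 K1 Lbar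
      using beta rho kernel convex minimizers lipschitz nonneg Lbar
      by unfold_locales auto
    have "0 \<le> KD" "0 \<le> Lbar * K1 / \<rho>"
      using KD_eq nonneg Lbar(1) rho by simp_all
    then obtain r where "0 < r" "r \<le> 1" "Lbar * K1 / \<rho> < (r - KD) * (1 - \<beta> * r)"
      using exists_rate[OF beta _ KD_less _ small contraction] by blast
    then show ?thesis
      using Q0 q KD_eq by (intro unique_TRMFE[of Q0 q KD r]) (auto simp: reg_def lip_def)
  qed
qed

end
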